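(* Let $\mathbb{F}$ be a field and let $A$ and $B$ be nilpotent diassociative algebras over $\mathbb{F}$. Let $\Phi=(\Phi_{\dashv},\Phi_{\vdash},\Phi_{\dashv}',\Phi_{\vdash}')$ be a tuple of linear maps $\Phi_*:B\to\mathscr{L}(A)/\mathrm{ad}_*^l(A)$ and $\Phi_*':B\to\mathscr{L}(A)/\mathrm{ad}_*^r(A)$ for $*\in\{\dashv,\vdash\}$. Let $\varphi$ and $\psi$ be lifts of $\Phi$ corresponding to extensions $0\to A\to L_{\varphi}\to B\to 0$ and $0\to A\to L_{\psi}\to B\to 0$ of diassociative algebras, respectively. Then $L_{\varphi}$ is nilpotent if and only if $L_{\psi}$ is nilpotent.
   Context: A diassociative algebra over $\mathbb{F}$ is an $\mathbb{F}$-vector space $D$ with two associative bilinear products $\dashv$ and $\vdash$ satisfying, for all $x,y,z\in D$: $x\dashv(y\dashv z)=x\dashv(y\vdash z)$; $(x\vdash y)\dashv z=x\vdash(y\dashv z)$; $(x\dashv y)\vdash z=(x\vdash y)\vdash z$. For subspaces $U,V$ of $D$ and $*\in\{\dashv,\vdash\}$, $U*V$ is the span of all $u*v$ ($u\in U$, $v\in V$), and $U\lozenge V=U\dashv V+U\vdash V$. Define $D^0=D$ and $D^{k+1}=D^0\lozenge D^k+D^1\lozenge D^{k-1}+\cdots+D^k\lozenge D^0$ for $k\ge 0$; $D$ is nilpotent if $D^u=0$ for some $u\ge0$. Throughout, $*$ ranges over $\{\dashv,\vdash\}$. $\mathscr{L}(A)$ is the space of linear maps $A\to A$. For $m\in A$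 let $\mathrm{ad}_*^l(m)(n)=m*n$ and $\mathrm{ad}_*^r(m)(n)=n*m$; $\mathrm{ad}_*^l(A)$ and $\mathrm{ad}_*^r(A)$ are the subspaces of $\mathscr{L}(A)$ consisting of these maps for $m \in A$. Let $q_*:\mathscr{L}(A)\to\mathscr{L}(A)/\mathrm{ad}_*^l(A)$ and $q_*':\mathscr{L}(A)\to\mathscr{L}(A)/\mathrm{ad}_*^r(A)$ be the natural projections. A lift of $\Phi$ is a tuple $\varphi=(\varphi_{\dashv},\varphi_{\vdash},\varphi_{\dashv}',\varphi_{\vdash}')$ of linear maps $B\to\mathscr{L}(A)$ with $q_*\varphi_*=\Phi_*$ and $q_*'\varphi_*'=\Phi_*'$. An extension of $A$ by $B$ is a short exact sequence $0\to A\xrightarrow{\sigma}L\xrightarrow{\pi}B\to0$ of diassociative algebras and homomorphisms (linear maps preserving both products). A section is a linear map $T:B\to L$ with $\pi T=\mathrm{id}_B$. A tuple $\varphi$ corresponds to the extension if there is a section $T$ such that $\varphi_*(i)m=\sigma^{-1}(T(i)*\sigma(m))$ and $\varphi_*'(i)m=\sigma^{-1}(\sigma(m)*T(i))$ for all $i\in B$, $m\in A$. *)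

theory Defs
  imports Complex_Main "HOL-Library.Set_Algebras" "HOL-Library.Function_Algebras"
begin

(* Sets are added elementwise (Set_Algebras), so on nonempty subspaces + is the sum of
   subspaces, and f +o W is the coset of f modulo W.  Functions are added pointwise
   (Function_Algebras). *)

section \<open>Diassociative algebras\<close>

(* Dashv and Vdash name the two products; a family indexed by this type is the part of a
   tuple in which * ranges over both of them. *)
datatype diop = Dashv | Vdash

locale diassociative_algebra = vector_space scale
  for scale :: "'f::field \<Rightarrow> 'a::ab_group_add \<Rightarrow> 'a" +
  fixes mult :: "diop \<Rightarrow> 'a \<Rightarrow> 'a \<Rightarrow> 'a"
  assumes linear_mult_right: "Vector_Spaces.linear scale scale (\<lambda>y. mult p x y)"
    and linear_mult_left: "Vector_Spaces.linear scale scale (\<lambda>x. mult p x y)"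
    and mult_assoc: "mult p (mult p x y) z = mult p x (mult p y z)"
    and dashv_dashv: "mult Dashv x (mult Dashv y z) = mult Dashv x (mult Vdash y z)"
    and vdash_dashv: "mult Dashv (mult Vdash x y) z = mult Vdash x (mult Dashv y z)"
    and dashv_vdash: "mult Vdash (mult Dashv x y) z = mult Vdash (mult Vdash x y) z"
begin

definition subspace_mult :: "diop \<Rightarrow> 'a set \<Rightarrow> 'a set \<Rightarrow> 'a set" where
  "subspace_mult p U V = span {mult p u v |u v. u \<in> U \<and> v \<in> V}"

definition lozenge :: "'a set \<Rightarrow> 'a set \<Rightarrow> 'a set"  (infixl "\<lozenge>" 70) where
  "U \<lozenge> V = subspace_mult Dashv U V + subspace_mult Vdash U V"

fun dpower :: "nat \<Rightarrow> 'a set" where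
  "dpower 0 = UNIV"
| "dpower (Suc k) = (\<Sum>i\<le>k. dpower i \<lozenge> dpower (k - i))"

definition nilpotent :: bool where
  "nilpotent \<longleftrightarrow> (\<exists>u. dpower u = {0})"

definition ad_l :: "diop \<Rightarrow> 'a \<Rightarrow> 'a \<Rightarrow> 'a" where
  "ad_l p m = (\<lambda>n. mult p m n)"

definition ad_r :: "diop \<Rightarrow> 'a \<Rightarrow> 'a \<Rightarrow> 'a" where
  "ad_r p m = (\<lambda>n. mult p n m)"

end

definition diassoc_hom ::
  "('f::field \<Rightarrow> 'a::ab_group_add \<Rightarrow> 'a) \<Rightarrow> (diop \<Rightarrow> 'a \<Rightarrow> 'a \<Rightarrow> 'a) \<Rightarrow>
   ('f \<Rightarrow> 'b::ab_group_add \<Rightarrow> 'b) \<Rightarrow> (diop \<Rightarrow> 'b \<Rightarrow> 'b \<Rightarrow> 'b) \<Rightarrow> ('a \<Rightarrow> 'b) \<Rightarrow> bool" where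
  "diassoc_hom sA mA sB mB h \<longleftrightarrow>
     Vector_Spaces.linear sA sB h \<and> (\<forall>p x y. h (mA p x y) = mB p (h x) (h y))"

section \<open>Linear maps into the space of endomorphisms and its quotients\<close>

definition endos :: "('f::field \<Rightarrow> 'a::ab_group_add \<Rightarrow> 'a) \<Rightarrow> ('a \<Rightarrow> 'a) set" where
  "endos s = {f. Vector_Spaces.linear s s f}"

definition endo_scale :: "('f::field \<Rightarrow> 'a::ab_group_add \<Rightarrow> 'a) \<Rightarrow> 'f \<Rightarrow> ('a \<Rightarrow> 'a) \<Rightarrow> 'a \<Rightarrow> 'a" where
  "endo_scale s c f = (\<lambda>x. s c (f x))"

definition linear_to_endos ::
  "('f::field \<Rightarrow> 'b::ab_group_add \<Rightarrow> 'b) \<Rightarrow> ('f \<Rightarrow> 'a::ab_group_add \<Rightarrow> 'a) \<Rightarrow> ('b \<Rightarrow> 'a \<Rightarrow> 'a) \<Rightarrow> bool" where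
  "linear_to_endos sB sA g \<longleftrightarrow>
     range g \<subseteq> endos sA \<and> Vector_Spaces.linear sB (endo_scale sA) g"

definition quotient_proj :: "('a::ab_group_add \<Rightarrow> 'a) set \<Rightarrow> ('a \<Rightarrow> 'a) \<Rightarrow> ('a \<Rightarrow> 'a) set" where
  "quotient_proj W f = f +o W"

definition endos_quotient ::
  "('f::field \<Rightarrow> 'a::ab_group_add \<Rightarrow> 'a) \<Rightarrow> ('a \<Rightarrow> 'a) set \<Rightarrow> ('a \<Rightarrow> 'a) set set" where
  "endos_quotient s W = quotient_proj W ` endos s"

(* W is added back because for c = 0 the elementwise multiple of a coset is {0}, not W. *)
definition quotient_scale ::
  "('f::field \<Rightarrow> 'a::ab_group_add \<Rightarrow> 'a) \<Rightarrow> ('a \<Rightarrow> 'a) set \<Rightarrow> 'f \<Rightarrow> ('a \<Rightarrow> 'a) set \<Rightarrow> ('a \<Rightarrow> 'a) set" where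
  "quotient_scale s W c C = endo_scale s c ` C + W"

definition linear_to_quotient ::
  "('f::field \<Rightarrow> 'b::ab_group_add \<Rightarrow> 'b) \<Rightarrow> ('f \<Rightarrow> 'a::ab_group_add \<Rightarrow> 'a) \<Rightarrow> ('a \<Rightarrow> 'a) set \<Rightarrow>
   ('b \<Rightarrow> ('a \<Rightarrow> 'a) set) \<Rightarrow> bool" where
  "linear_to_quotient sB sA W G \<longleftrightarrow>
     range G \<subseteq> endos_quotient sA W \<and>
     (\<forall>x y. G (x + y) = G x + G y) \<and>
     (\<forall>c x. G (sB c x) = quotient_scale sA W c (G x))"

section \<open>Lifts and extensions\<close>

(* A tuple (phi_dashv, phi_vdash, phi'_dashv, phi'_vdash) is given by two families phi, phi'
   indexed by the product. *)
definition quotient_tuple ::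
  "('f::field \<Rightarrow> 'a::ab_group_add \<Rightarrow> 'a) \<Rightarrow> (diop \<Rightarrow> 'a \<Rightarrow> 'a \<Rightarrow> 'a) \<Rightarrow>
   ('f \<Rightarrow> 'b::ab_group_add \<Rightarrow> 'b) \<Rightarrow>
   (diop \<Rightarrow> 'b \<Rightarrow> ('a \<Rightarrow> 'a) set) \<Rightarrow> (diop \<Rightarrow> 'b \<Rightarrow> ('a \<Rightarrow> 'a) set) \<Rightarrow> bool" where
  "quotient_tuple sA mA sB \<Phi> \<Phi>' \<longleftrightarrow>
     (\<forall>p. linear_to_quotient sB sA (range (diassociative_algebra.ad_l mA p)) (\<Phi> p) \<and>
          linear_to_quotient sB sA (range (diassociative_algebra.ad_r mA p)) (\<Phi>' p))"

definition is_lift ::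
  "('f::field \<Rightarrow> 'a::ab_group_add \<Rightarrow> 'a) \<Rightarrow> (diop \<Rightarrow> 'a \<Rightarrow> 'a \<Rightarrow> 'a) \<Rightarrow>
   ('f \<Rightarrow> 'b::ab_group_add \<Rightarrow> 'b) \<Rightarrow>
   (diop \<Rightarrow> 'b \<Rightarrow> ('a \<Rightarrow> 'a) set) \<Rightarrow> (diop \<Rightarrow> 'b \<Rightarrow> ('a \<Rightarrow> 'a) set) \<Rightarrow>
   (diop \<Rightarrow> 'b \<Rightarrow> 'a \<Rightarrow> 'a) \<Rightarrow> (diop \<Rightarrow> 'b \<Rightarrow> 'a \<Rightarrow> 'a) \<Rightarrow> bool" where
  "is_lift sA mA sB \<Phi> \<Phi>' \<phi> \<phi>' \<longleftrightarrow>
     (\<forall>p. linear_to_endos sB sA (\<phi> p) \<and> linear_to_endos sB sA (\<phi>' p) \<and>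
          quotient_proj (range (diassociative_algebra.ad_l mA p)) \<circ> \<phi> p = \<Phi> p \<and>
          quotient_proj (range (diassociative_algebra.ad_r mA p)) \<circ> \<phi>' p = \<Phi>' p)"

definition is_extension ::
  "('f::field \<Rightarrow> 'a::ab_group_add \<Rightarrow> 'a) \<Rightarrow> (diop \<Rightarrow> 'a \<Rightarrow> 'a \<Rightarrow> 'a) \<Rightarrow>
   ('f \<Rightarrow> 'l::ab_group_add \<Rightarrow> 'l) \<Rightarrow> (diop \<Rightarrow> 'l \<Rightarrow> 'l \<Rightarrow> 'l) \<Rightarrow>
   ('f \<Rightarrow> 'b::ab_group_add \<Rightarrow> 'b) \<Rightarrow> (diop \<Rightarrow> 'b \<Rightarrow> 'b \<Rightarrow> 'b) \<Rightarrow>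
   ('a \<Rightarrow> 'l) \<Rightarrow> ('l \<Rightarrow> 'b) \<Rightarrow> bool" where
  "is_extension sA mA sL mL sB mB \<sigma> \<pi> \<longleftrightarrow>
     diassociative_algebra sA mA \<and> diassociative_algebra sL mL \<and> diassociative_algebra sB mB \<and>
     diassoc_hom sA mA sL mL \<sigma> \<and> diassoc_hom sL mL sB mB \<pi> \<and>
     inj \<sigma> \<and> range \<sigma> = {x. \<pi> x = 0} \<and> surj \<pi>"

definition is_section ::
  "('f::field \<Rightarrow> 'b::ab_group_add \<Rightarrow> 'b) \<Rightarrow> ('f \<Rightarrow> 'l::ab_group_add \<Rightarrow> 'l) \<Rightarrow>
   ('l \<Rightarrow> 'b) \<Rightarrow> ('b \<Rightarrow> 'l) \<Rightarrow> bool" where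
  "is_section sB sL \<pi> T \<longleftrightarrow> Vector_Spaces.linear sB sL T \<and> \<pi> \<circ> T = id"

(* The products below lie in the kernel of \<pi>, that is, in the range of the injection \<sigma>,
   so inv \<sigma> is a genuine inverse there. *)
definition corresponds ::
  "('f::field \<Rightarrow> 'l::ab_group_add \<Rightarrow> 'l) \<Rightarrow> (diop \<Rightarrow> 'l \<Rightarrow> 'l \<Rightarrow> 'l) \<Rightarrow>
   ('f \<Rightarrow> 'b::ab_group_add \<Rightarrow> 'b) \<Rightarrow> ('a \<Rightarrow> 'l) \<Rightarrow> ('l \<Rightarrow> 'b) \<Rightarrow>
   (diop \<Rightarrow> 'b \<Rightarrow> 'a \<Rightarrow> 'a) \<Rightarrow> (diop \<Rightarrow> 'b \<Rightarrow> 'a \<Rightarrow> 'a) \<Rightarrow> bool" where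
  "corresponds sL mL sB \<sigma> \<pi> \<phi> \<phi>' \<longleftrightarrow>
     (\<exists>T. is_section sB sL \<pi> T \<and>
          (\<forall>p i m. \<phi> p i m = inv \<sigma> (mL p (T i) (\<sigma> m)) \<and>
                   \<phi>' p i m = inv \<sigma> (mL p (\<sigma> m) (T i))))"

end

theory Submission
  imports Defs
begin

text \<open>
  Left and right multiplications by elements of an extension \<open>L\<close> act on the ideal \<open>A\<close> exactly
  by the maps lying in the cosets \<open>\<Phi>\<^sub>* i\<close> and \<open>\<Phi>'\<^sub>* i\<close>; hence \<open>L\<^sub>\<phi>\<close> and \<open>L\<^sub>\<psi>\<close> induce the same set of
  operators on \<open>A\<close>. Nilpotency of \<open>L\<close> is determined by this set: if \<open>B\<close> is nilpotent, then \<open>L\<close> is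
  nilpotent if and only if all sufficiently long words in these operators vanish on \<open>A\<close>. For the
  nontrivial direction, one of the two factors of a long product contains at least half of the
  letters. Descending repeatedly into the longer factor writes the product as a long operator word
  applied to a product which is still long enough to be zero in \<open>B\<close>, that is, to lie in \<open>A\<close>.
\<close>

section \<open>Products, sums of subspaces and the powers \<open>dpower\<close>\<close>

context diassociative_algebra
begin

lemma mult_zero [simp]: "mult p 0 y = 0" "mult p x 0 = 0"
  using linear_mult_left[of p y] linear_mult_right[of p x]
  by (auto dest: module_hom.zero simp: linear_iff_module_hom)

lemma mult_add: "mult p (x + x') y = mult p x y + mult p x' y"
  "mult p x (y + y') = mult p x y + mult p x y'"
  using linear_mult_left[of p y] linear_mult_right[of p x]
  by (auto dest: module_hom.add simp: linear_iff_module_hom)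

lemma mult_scale: "mult p (scale c x) y = scale c (mult p x y)"
  "mult p x (scale c y) = scale c (mult p x y)"
  using linear_mult_left[of p y] linear_mult_right[of p x]
  by (auto dest: module_hom.scale simp: linear_iff_module_hom)

lemma subspace_set_plus:
  assumes "subspace U" "subspace V" shows "subspace (U + V)"
proof -
  have "U + V = {x + y |x y. x \<in> U \<and> y \<in> V}"
    by (auto simp: set_plus_def)
  then show ?thesis
    using subspace_sums[OF assms] by simp
qed

lemma subspace_set_sum:
  assumes "\<And>i. i \<in> I \<Longrightarrow> subspace (U i)" shows "subspace (\<Sum>i\<in>I. U i)"
  using assms
proof (induction I rule: infinite_finite_induct)
  case (insert i I)
  then show ?case by (simp add: subspace_set_plus)
qed (simp_all add: set_zero)

lemma set_sum_subset:
  assumes "subspace S" "\<And>i. i \<in> I \<Longrightarrow> U i \<subseteq> S" shows "(\<Sum>i\<in>I. U i) \<subseteq> S"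
  using assms
proof (induction I rule: infinite_finite_induct)
  case (insert i I)
  then have "U i \<subseteq> S" "(\<Sum>i\<in>I. U i) \<subseteq> S"
    by auto
  then show ?case
    using insert.hyps subspace_add[OF \<open>subspace S\<close>] by (auto elim!: set_plus_elim)
qed (simp_all add: set_zero subspace_0)

lemma subset_set_sum:
  assumes "finite I" "j \<in> I" "\<And>i. i \<in> I \<Longrightarrow> subspace (U i)" shows "U j \<subseteq> (\<Sum>i\<in>I. U i)"
proof
  fix x assume "x \<in> U j"
  moreover have "0 \<in> (\<Sum>i\<in>I - {j}. U i)"
    using assms by (intro subspace_0 subspace_set_sum) auto
  ultimately have "x + 0 \<in> U j + (\<Sum>i\<in>I - {j}. U i)"
    by (rule set_plus_intro)
  then show "x \<in> (\<Sum>i\<in>I. U i)"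
    using assms by (simp add: sum.remove)
qed

lemma subspace_lozenge: "subspace (U \<lozenge> V)"
  by (simp add: lozenge_def subspace_mult_def subspace_set_plus)

lemma mult_in_lozenge:
  assumes "x \<in> U" "y \<in> V" shows "mult p x y \<in> U \<lozenge> V"
proof -
  have "mult p x y \<in> subspace_mult p U V"
    unfolding subspace_mult_def using assms by (auto intro!: span_base)
  moreover have "0 \<in> subspace_mult q U V" for q
    by (simp add: subspace_mult_def span_zero)
  ultimately show ?thesis
    unfolding lozenge_def
    using set_plus_intro[of "mult p x y" _ 0] set_plus_intro[of 0 _ "mult p x y"]
    by (cases p) simp_all
qed

lemma lozenge_subset:
  assumes "subspace S" "\<And>p x y. x \<in> U \<Longrightarrow> y \<in> V \<Longrightarrow> mult p x y \<in> S" shows "U \<lozenge> V \<subseteq> S"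
proof -
  have "subspace_mult p U V \<subseteq> S" for p
    unfolding subspace_mult_def by (rule span_minimal) (use assms in auto)
  then show ?thesis
    unfolding lozenge_def using subspace_add[OF \<open>subspace S\<close>] by (blast elim: set_plus_elim)
qed

lemma subspace_dpower: "subspace (dpower k)"
  by (cases k) (simp_all add: subspace_set_sum subspace_lozenge)

lemma dpower_Suc_subset:
  assumes "subspace S"
    and "\<And>p i x y. i \<le> k \<Longrightarrow> x \<in> dpower i \<Longrightarrow> y \<in> dpower (k - i) \<Longrightarrow> mult p x y \<in> S"
  shows "dpower (Suc k) \<subseteq> S"
  unfolding dpower.simps by (intro set_sum_subset lozenge_subset) (use assms in auto)

text \<open>Index k stands for products of k + 1 letters, and (i + 1) + (j + 1) letters give the
  index i + j + 1.\<close>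

lemma mult_in_dpower:
  assumes "x \<in> dpower i" "y \<in> dpower j" shows "mult p x y \<in> dpower (Suc (i + j))"
proof -
  have "dpower i \<lozenge> dpower (i + j - i) \<subseteq> (\<Sum>l\<le>i + j. dpower l \<lozenge> dpower (i + j - l))"
    by (rule subset_set_sum) (auto simp: subspace_lozenge)
  then show ?thesis
    using mult_in_lozenge[OF assms] by auto
qed

text \<open>For k > 0, one of the two factors of a product has positive index. Lowering that index
  by one, by the induction hypothesis, lowers the index of the product by one; the cases on
  \<open>i\<close> choose the factor.\<close>

lemma dpower_Suc_le: "dpower (Suc k) \<subseteq> dpower k"
proof (induction k rule: less_induct)
  case (less k)
  show ?case
  proof (cases k)
    case (Suc n)
    show ?thesis
    proof (rule dpower_Suc_subset[OF subspace_dpower])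
      fix p i x y
      assume i: "i \<le> k" and x: "x \<in> dpower i" and y: "y \<in> dpower (k - i)"
      show "mult p x y \<in> dpower k"
      proof (cases i)
        case 0
        then have "y \<in> dpower n"
          using less.IH[of n] y Suc by auto
        then show ?thesis
          using mult_in_dpower[of x 0 y n p] Suc by simp
      next
        case (Suc j)
        then have "x \<in> dpower j"
          using less.IH[of j] x i by auto
        then show ?thesis
          using mult_in_dpower[of x j y "k - i" p] y i Suc by simp
      qed
    qed
  qed simp
qed

lemma dpower_antimono: "i \<le> j \<Longrightarrow> dpower j \<subseteq> dpower i"
  by (rule lift_Suc_antimono_le[of dpower]) (use dpower_Suc_le in auto)

section \<open>The annihilator series, like an upper central series: level n is what all words of n
  one-sided multiplications kill\<close>

fun upper_annihilator :: "nat \<Rightarrow> 'a set" where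
  "upper_annihilator 0 = {0}"
| "upper_annihilator (Suc n) =
     {x. \<forall>p y. mult p x y \<in> upper_annihilator n \<and> mult p y x \<in> upper_annihilator n}"

lemma subspace_upper_annihilator: "subspace (upper_annihilator n)"
proof (induction n)
  case (Suc n)
  then show ?case
    by (auto intro!: subspaceI
        simp: mult_add mult_scale subspace_0 subspace_add subspace_scale)
qed simp

text \<open>Multiplying by an arbitrary element, that is, one of \<open>dpower 0\<close>, raises the
  index by one, so n multiplications lead from \<open>dpower k\<close> into
  \<open>dpower (k + n)\<close>.\<close>

lemma dpower_subset_upper_annihilator:
  "dpower (k + n) = {0} \<Longrightarrow> dpower k \<subseteq> upper_annihilator n"
proof (induction n arbitrary: k)
  case (Suc n)
  then have "dpower (Suc k) \<subseteq> upper_annihilator n"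
    by (metis add_Suc_shift)
  then show ?case
    using mult_in_dpower[of _ k _ 0] mult_in_dpower[of _ 0 _ k] by fastforce
qed simp

text \<open>\<open>dpower u\<close> is spanned by products of \<open>u + 1\<close> letters. One of the two factors of a
  product of \<open>2 u + 2\<close> letters has at least \<open>u + 1\<close> of them, so each step down the annihilator
  series doubles the required length.\<close>

lemma dpower_eq_zero_of_subset_upper_annihilator:
  "dpower u \<subseteq> upper_annihilator n \<Longrightarrow> \<exists>k. dpower k = {0}"
proof (induction n arbitrary: u)
  case 0
  then show ?case
    using subspace_0[OF subspace_dpower] by auto
next
  case (Suc n)
  have "dpower (Suc (2 * u)) \<subseteq> upper_annihilator n"
  proof (rule dpower_Suc_subset[OF subspace_upper_annihilator])
    fix p i x y
    assume "i \<le> 2 * u" and x: "x \<in> dpower i" and y: "y \<in> dpower (2 * u - i)"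
    consider "u \<le> i" | "u \<le> 2 * u - i"
      by linarith
    then show "mult p x y \<in> upper_annihilator n"
    proof cases
      case 1
      then have "x \<in> upper_annihilator (Suc n)"
        using dpower_antimono Suc.prems x by blast
      then show ?thesis by simp
    next
      case 2
      then have "y \<in> upper_annihilator (Suc n)"
        using dpower_antimono Suc.prems y by blast
      then show ?thesis by simp
    qed
  qed
  then show ?case
    by (rule Suc.IH)
qed

lemma nilpotent_iff_subset_upper_annihilator:
  assumes "dpower u \<subseteq> I"
  shows "nilpotent \<longleftrightarrow> (\<exists>n. I \<subseteq> upper_annihilator n)"
proof
  assume nilpotent
  \<comment> \<open>The summand 0 selects k = 0 in the next fact, where \<open>dpower 0\<close> is
    the whole algebra and so contains \<open>I\<close>.\<close>
  then obtain n where "dpower (0 + n) = {0}"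
    unfolding nilpotent_def by auto
  from dpower_subset_upper_annihilator[OF this] show "\<exists>n. I \<subseteq> upper_annihilator n"
    by auto
next
  assume "\<exists>n. I \<subseteq> upper_annihilator n"
  then show nilpotent
    unfolding nilpotent_def
    using assms dpower_eq_zero_of_subset_upper_annihilator by blast
qed

end

section \<open>Homomorphisms and nilpotency of extensions\<close>

lemma diassoc_hom_dpower:
  assumes "diassociative_algebra sA mA" "diassociative_algebra sB mB" "diassoc_hom sA mA sB mB h"
  shows "h ` diassociative_algebra.dpower sA mA k \<subseteq> diassociative_algebra.dpower sB mB k"
proof (induction k rule: less_induct)
  interpret A: diassociative_algebra sA mA by fact
  interpret B: diassociative_algebra sB mB by fact
  interpret h: Vector_Spaces.linear sA sB h
    using assms(3) by (simp add: diassoc_hom_def)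
  case (less k)
  show ?case
  proof (cases k)
    case 0
    then show ?thesis by simp
  next
    case (Suc n)
    \<comment> \<open>The preimage is a subspace, so it is enough to test products.\<close>
    have "A.dpower (Suc n) \<subseteq> h -` B.dpower (Suc n)"
    proof (rule A.dpower_Suc_subset)
      show "A.subspace (h -` B.dpower (Suc n))"
        by (intro h.subspace_vimage B.subspace_dpower)
      fix p i x y
      assume "i \<le> n" "x \<in> A.dpower i" "y \<in> A.dpower (n - i)"
      moreover from this have "h x \<in> B.dpower i" "h y \<in> B.dpower (n - i)"
        using less.IH[of i] less.IH[of "n - i"] diff_less_Suc[of n i] Suc by auto
      ultimately show "mA p x y \<in> h -` B.dpower (Suc n)"
        using B.mult_in_dpower[of "h x" i "h y" "n - i" p] assms(3) by (simp add: diassoc_hom_def)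
    qed
    then show ?thesis
      using Suc by auto
  qed
qed

text \<open>The counterpart of \<open>upper_annihilator\<close> formed inside A from a set of
  operators alone, so that different extensions can be compared.\<close>

fun operator_kernel :: "('a::zero \<Rightarrow> 'a) set \<Rightarrow> nat \<Rightarrow> 'a set" where
  "operator_kernel S 0 = {0}"
| "operator_kernel S (Suc n) = {a. \<forall>f\<in>S. f a \<in> operator_kernel S n}"

text \<open>The last three hypotheses say that \<open>S\<close> consists exactly of the operators on
  A induced by one-sided multiplications in L. Hence \<open>\<sigma>\<close> pulls the annihilator
  series of L back to the kernels of words in \<open>S\<close>.\<close>

lemma nilpotent_extension_iff:
  fixes S :: "('a::ab_group_add \<Rightarrow> 'a) set"
  assumes ext: "is_extension sA mA sL mL sB mB \<sigma> \<pi>"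
    and nil: "diassociative_algebra.nilpotent sB mB"
    and realised: "\<And>f. f \<in> S \<Longrightarrow>
      \<exists>p x. (\<forall>a. \<sigma> (f a) = mL p x (\<sigma> a)) \<or> (\<forall>a. \<sigma> (f a) = mL p (\<sigma> a) x)"
    and left: "\<And>p x. \<exists>f\<in>S. \<forall>a. \<sigma> (f a) = mL p x (\<sigma> a)"
    and right: "\<And>p x. \<exists>f\<in>S. \<forall>a. \<sigma> (f a) = mL p (\<sigma> a) x"
  shows "diassociative_algebra.nilpotent sL mL \<longleftrightarrow> (\<exists>n. operator_kernel S n = UNIV)"
proof -
  interpret L: diassociative_algebra sL mL
    using ext by (simp add: is_extension_def)
  interpret B: diassociative_algebra sB mB
    using ext by (simp add: is_extension_def)
  interpret \<sigma>: Vector_Spaces.linear sA sL \<sigma>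
    using ext by (simp add: is_extension_def diassoc_hom_def)
  have "inj \<sigma>" and range: "range \<sigma> = {x. \<pi> x = 0}" and hom: "diassoc_hom sL mL sB mB \<pi>"
    using ext by (simp_all add: is_extension_def)
  obtain u where "B.dpower u = {0}"
    using nil unfolding B.nilpotent_def by blast
  \<comment> \<open>\<open>\<pi>\<close> maps \<open>L.dpower u\<close> into
    \<open>B.dpower u\<close>, which is zero, and its kernel is the range of
    \<open>\<sigma>\<close>.\<close>
  then have "L.dpower u \<subseteq> range \<sigma>"
    using diassoc_hom_dpower[OF L.diassociative_algebra_axioms B.diassociative_algebra_axioms hom, of u]
    by (auto simp: range)
  then have "L.nilpotent \<longleftrightarrow> (\<exists>n. range \<sigma> \<subseteq> L.upper_annihilator n)"
    by (rule L.nilpotent_iff_subset_upper_annihilator)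
  moreover have "\<sigma> a \<in> L.upper_annihilator n \<longleftrightarrow> a \<in> operator_kernel S n" for a n
  proof (induction n arbitrary: a)
    case 0
    have "\<sigma> a = 0 \<longleftrightarrow> a = 0"
      using \<open>inj \<sigma>\<close> by (metis \<sigma>.zero injD)
    then show ?case by simp
  next
    case (Suc n)
    show ?case
    proof
      assume a: "\<sigma> a \<in> L.upper_annihilator (Suc n)"
      have "\<sigma> (f a) \<in> L.upper_annihilator n" if f: "f \<in> S" for f
        using realised[OF f] a by auto
      then show "a \<in> operator_kernel S (Suc n)"
        using Suc.IH by simp
    next
      assume "a \<in> operator_kernel S (Suc n)"
      then have a: "\<sigma> (f a) \<in> L.upper_annihilator n" if "f \<in> S" for f
        using that Suc.IH by simp
      have "mL p (\<sigma> a) x \<in> L.upper_annihilator n" "mL p x (\<sigma> a) \<in> L.upper_annihilator n" for p x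
        using left[of p x] right[of p x] a by metis+
      then show "\<sigma> a \<in> L.upper_annihilator (Suc n)"
        by simp
    qed
  qed
  ultimately show ?thesis
    by (simp add: image_subset_iff set_eq_iff)
qed

section \<open>The operators determined by \<open>\<Phi>\<close>, and lifts\<close>

definition coset_operators ::
  "(diop \<Rightarrow> 'b \<Rightarrow> ('a \<Rightarrow> 'a) set) \<Rightarrow> (diop \<Rightarrow> 'b \<Rightarrow> ('a \<Rightarrow> 'a) set) \<Rightarrow> ('a \<Rightarrow> 'a) set" where
  "coset_operators \<Phi> \<Phi>' = (\<Union>p i. \<Phi> p i \<union> \<Phi>' p i)"

text \<open>The criterion on the right mentions neither the lift nor L, so it is the same for any
  two extensions belonging to \<open>\<Phi>\<close>.\<close>

lemma nilpotent_lift_iff: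
  assumes lift: "is_lift sA mA sB \<Phi> \<Phi>' \<phi> \<phi>'"
    and ext: "is_extension sA mA sL mL sB mB \<sigma> \<pi>"
    and nil: "diassociative_algebra.nilpotent sB mB"
    and corr: "corresponds sL mL sB \<sigma> \<pi> \<phi> \<phi>'"
  shows "diassociative_algebra.nilpotent sL mL \<longleftrightarrow>
    (\<exists>n. operator_kernel (coset_operators \<Phi> \<Phi>') n = UNIV)"
proof -
  interpret A: diassociative_algebra sA mA
    using ext by (simp add: is_extension_def)
  interpret L: diassociative_algebra sL mL
    using ext by (simp add: is_extension_def)
  interpret B: diassociative_algebra sB mB
    using ext by (simp add: is_extension_def)
  interpret \<sigma>: Vector_Spaces.linear sA sL \<sigma>
    using ext by (simp add: is_extension_def diassoc_hom_def)
  interpret \<pi>: Vector_Spaces.linear sL sB \<pi>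
    using ext by (simp add: is_extension_def diassoc_hom_def)
  have range: "range \<sigma> = {x. \<pi> x = 0}"
    and \<sigma>_mult: "\<sigma> (mA p a b) = mL p (\<sigma> a) (\<sigma> b)"
    and \<pi>_mult: "\<pi> (mL p x y) = mB p (\<pi> x) (\<pi> y)" for p a b x y
    using ext by (simp_all add: is_extension_def diassoc_hom_def)
  have \<pi>_\<sigma>: "\<pi> (\<sigma> a) = 0" for a
    using range by auto
  obtain T where T: "is_section sB sL \<pi> T"
    and \<phi>: "\<And>p i a. \<phi> p i a = inv \<sigma> (mL p (T i) (\<sigma> a))"
    and \<phi>': "\<And>p i a. \<phi>' p i a = inv \<sigma> (mL p (\<sigma> a) (T i))"
    using corr unfolding corresponds_def by blast
  have \<pi>_T: "\<pi> (T i) = i" for i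
    using T by (auto simp: is_section_def dest: fun_cong[of _ _ i])
  \<comment> \<open>\<open>\<pi>\<close> sends these products to a product with 0, so they lie in
    the range of \<open>\<sigma>\<close> and \<open>inv \<sigma>\<close> cancels.\<close>
  have \<sigma>_\<phi>: "\<sigma> (\<phi> p i a) = mL p (T i) (\<sigma> a)" "\<sigma> (\<phi>' p i a) = mL p (\<sigma> a) (T i)" for p i a
    unfolding \<phi> \<phi>' by (rule f_inv_into_f, simp add: range \<pi>_mult \<pi>_\<sigma>)+
  have \<Phi>: "\<Phi> p i = {\<phi> p i + A.ad_l p m |m. True}"
    and \<Phi>': "\<Phi>' p i = {\<phi>' p i + A.ad_r p m |m. True}" for p i
  proof -
    have "\<Phi> p = quotient_proj (range (A.ad_l p)) \<circ> \<phi> p"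
      "\<Phi>' p = quotient_proj (range (A.ad_r p)) \<circ> \<phi>' p"
      using lift by (simp_all add: is_lift_def)
    then show "\<Phi> p i = {\<phi> p i + A.ad_l p m |m. True}" "\<Phi>' p i = {\<phi>' p i + A.ad_r p m |m. True}"
      by (auto simp: quotient_proj_def elt_set_plus_def)
  qed
  \<comment> \<open>Moving \<open>T i\<close> by \<open>\<sigma> m\<close> changes the induced
    operator by \<open>ad_l p m\<close> or \<open>ad_r p m\<close>, which is a move within its
    coset.\<close>
  have \<sigma>_l: "\<sigma> ((\<phi> p i + A.ad_l p m) a) = mL p (T i + \<sigma> m) (\<sigma> a)"
    and \<sigma>_r: "\<sigma> ((\<phi>' p i + A.ad_r p m) a) = mL p (\<sigma> a) (T i + \<sigma> m)" for p i m a
    by (simp_all add: A.ad_l_def A.ad_r_def \<sigma>.add \<sigma>_\<phi> \<sigma>_mult L.mult_add)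
  \<comment> \<open>Since the elements \<open>T i + \<sigma> m\<close> exhaust L, every
    multiplication of L induces an operator from these cosets.\<close>
  have split: "\<exists>i m. x = T i + \<sigma> m" for x
  proof -
    have "x - T (\<pi> x) \<in> range \<sigma>"
      by (simp add: range \<pi>.diff \<pi>_T)
    then obtain m where "x - T (\<pi> x) = \<sigma> m"
      by blast
    then have "x = T (\<pi> x) + \<sigma> m"
      by (simp add: algebra_simps)
    then show ?thesis
      by blast
  qed
  show ?thesis
  proof (rule nilpotent_extension_iff[OF ext nil])
    fix f assume "f \<in> coset_operators \<Phi> \<Phi>'"
    then obtain p i m where "f = \<phi> p i + A.ad_l p m \<or> f = \<phi>' p i + A.ad_r p m"
      unfolding coset_operators_def \<Phi> \<Phi>' by blast
    then show "\<exists>p x. (\<forall>a. \<sigma> (f a) = mL p x (\<sigma> a)) \<or> (\<forall>a. \<sigma> (f a) = mL p (\<sigma> a) x)"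
      using \<sigma>_l \<sigma>_r by metis
  next
    fix p x
    obtain i m where x: "x = T i + \<sigma> m"
      using split by blast
    have "\<phi> p i + A.ad_l p m \<in> coset_operators \<Phi> \<Phi>'" "\<phi>' p i + A.ad_r p m \<in> coset_operators \<Phi> \<Phi>'"
      unfolding coset_operators_def \<Phi> \<Phi>' by blast+
    then show "\<exists>f\<in>coset_operators \<Phi> \<Phi>'. \<forall>a. \<sigma> (f a) = mL p x (\<sigma> a)"
      "\<exists>f\<in>coset_operators \<Phi> \<Phi>'. \<forall>a. \<sigma> (f a) = mL p (\<sigma> a) x"
      unfolding x using \<sigma>_l \<sigma>_r by blast+
  qed
qed

theorem theorem4p7:
  fixes sA :: "'f::field \<Rightarrow> 'a::ab_group_add \<Rightarrow> 'a"
    and sB :: "'f \<Rightarrow> 'b::ab_group_add \<Rightarrow> 'b"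
    and sL :: "'f \<Rightarrow> 'l::ab_group_add \<Rightarrow> 'l"
    and sM :: "'f \<Rightarrow> 'm::ab_group_add \<Rightarrow> 'm"
    and mA :: "diop \<Rightarrow> 'a \<Rightarrow> 'a \<Rightarrow> 'a"
    and mB :: "diop \<Rightarrow> 'b \<Rightarrow> 'b \<Rightarrow> 'b"
    and mL :: "diop \<Rightarrow> 'l \<Rightarrow> 'l \<Rightarrow> 'l"
    and mM :: "diop \<Rightarrow> 'm \<Rightarrow> 'm \<Rightarrow> 'm"
    and \<Phi> \<Phi>' :: "diop \<Rightarrow> 'b \<Rightarrow> ('a \<Rightarrow> 'a) set"
    and \<phi> \<phi>' \<psi> \<psi>' :: "diop \<Rightarrow> 'b \<Rightarrow> 'a \<Rightarrow> 'a"
    and \<sigma>\<^sub>L :: "'a \<Rightarrow> 'l" and \<pi>\<^sub>L :: "'l \<Rightarrow> 'b"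
    and \<sigma>\<^sub>M :: "'a \<Rightarrow> 'm" and \<pi>\<^sub>M :: "'m \<Rightarrow> 'b"
  assumes "diassociative_algebra sA mA" and "diassociative_algebra.nilpotent sA mA"
    and "diassociative_algebra sB mB" and "diassociative_algebra.nilpotent sB mB"
    and "quotient_tuple sA mA sB \<Phi> \<Phi>'"
    and "is_lift sA mA sB \<Phi> \<Phi>' \<phi> \<phi>'"
    and "is_lift sA mA sB \<Phi> \<Phi>' \<psi> \<psi>'"
    and "is_extension sA mA sL mL sB mB \<sigma>\<^sub>L \<pi>\<^sub>L"
    and "corresponds sL mL sB \<sigma>\<^sub>L \<pi>\<^sub>L \<phi> \<phi>'"
    and "is_extension sA mA sM mM sB mB \<sigma>\<^sub>M \<pi>\<^sub>M"
    and "corresponds sM mM sB \<sigma>\<^sub>M \<pi>\<^sub>M \<psi> \<psi>'"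
  shows "diassociative_algebra.nilpotent sL mL \<longleftrightarrow> diassociative_algebra.nilpotent sM mM"
  using nilpotent_lift_iff[OF assms(6,8,4,9)] nilpotent_lift_iff[OF assms(7,10,4,11)] by simp

end
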